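(* Let $\mathbb{K}$ be a field, $d\ge 0$ an integer, $\mathcal{A}$ a $\mathbb{K}$-algebra isomorphic to $\mathrm{Mat}_{d+1}(\mathbb{K})$, and let $\Phi=(A;\{E_i\}_{i=0}^d;A^*;\{E^*_i\}_{i=0}^d)$ be a Leonard system in $\mathcal{A}$ with parameter array $(\{\theta_i\}_{i=0}^d;\{\theta^*_i\}_{i=0}^d;\{\varphi_i\}_{i=1}^d;\{\phi_i\}_{i=1}^d)$. Let $\tau_i,\eta_i,\tau^*_i,\eta^*_i$ $(0\le i\le d)$ be the polynomials attached to $\Phi$. Then for $0\le i\le d$ all of the following hold: $$E_0E^*_0\,\eta_i(A)=\frac{\phi_1\phi_2\cdots\phi_i}{\eta^*_d(\theta^*_0)}\,E_0\,\eta^*_{d-i}(A^* ),$$ $$E_0E^*_d\,\eta_i(A)=\frac{\varphi_d\varphi_{d-1}\cdots\varphi_{d-i+1}}{\tau^*_d(\theta^*_d)}\,E_0\,\tau^*_{d-i}(A^* ),$$ $$E_dE^*_0\,\tau_i(A)=\frac{\varphi_1\varphi_2\cdots\varphi_i}{\eta^*_d(\theta^*_0)}\,E_d\,\eta^*_{d-i}(A^* ),$$ $$E_dE^*_d\,\tau_i(A)=\frac{\phi_d\phi_{d-1}\cdots\phi_{d-i+1}}{\tau^*_d(\theta^*_d)}\,E_d\,\tau^*_{d-i}(A^* ),$$ $$E^*_0E_0\,\eta^*_i(A^* )=\frac{\phi_d\phi_{d-1}\cdots\phi_{d-i+1}}{\eta_d(\theta_0)}\,E^*_0\,\eta_{d-i}(A),$$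 $$E^*_0E_d\,\eta^*_i(A^* )=\frac{\varphi_d\varphi_{d-1}\cdots\varphi_{d-i+1}}{\tau_d(\theta_d)}\,E^*_0\,\tau_{d-i}(A),$$ $$E^*_dE_0\,\tau^*_i(A^* )=\frac{\varphi_1\varphi_2\cdots\varphi_i}{\eta_d(\theta_0)}\,E^*_d\,\eta_{d-i}(A),$$ $$E^*_dE_d\,\tau^*_i(A^* )=\frac{\phi_1\phi_2\cdots\phi_i}{\tau_d(\theta_d)}\,E^*_d\,\tau_{d-i}(A).$$
   Context: Notation: $A^*$ is just the name of an element (not the conjugate-transpose of $A$). Empty products equal $1$. $V$ denotes a simple $\mathcal{A}$-module (unique up to isomorphism, of dimension $d+1$ over $\mathbb{K}$). Primitive idempotents. An element $A\in\mathcal{A}$ is multiplicity-free if it has $d+1$ mutually distinct eigenvalues in $\mathbb{K}$. If $\theta_0,\dots,\theta_d$ is an ordering of these eigenvalues, the primitive idempotent of $A$ associated with $\theta_i$ is $E_i=\prod_{0\le j\le d,\ j\ne i}\frac{A-\theta_jI}{\theta_i-\theta_j}$. Leonard system. A Leonard system in $\mathcal{A}$ is a sequence $\Phi=(A;\{E_i\}_{i=0}^d;A^*;\{E^*_i\}_{i=0}^d)$ such that: (i) $A,A^*\in\mathcal{A}$ are both multiplicity-free; (ii) $E_0,\dots,E_d$ is an ordering of the primitive idempotents of $A$; (iii) $E^*_0,\dots,E^*_d$ is an ordering of the primitive idempotents of $A^*$; (iv) for $0\le i,j\le d$, $E_iA^*E_j=0$ if $|i-j|>1$ and $E_iA^*E_j\neq0$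 if $|i-j|=1$; (v) for $0\le i,j\le d$, $E^*_iAE^*_j=0$ if $|i-j|>1$ and $E^*_iAE^*_j\ne0$ if $|i-j|=1$. Parameter array. $\theta_i$ is the eigenvalue of $A$ associated with $E_i$, and $\theta^*_i$ is the eigenvalue of $A^*$ associated with $E^*_i$. For $0\le i\le d$ put $U_i=(E^*_0V+\cdots+E^*_iV)\cap(E_iV+\cdots+E_dV)$. It is known that each $U_i$ is $1$-dimensional, $V=U_0\oplus\cdots\oplus U_d$, $(A-\theta_iI)U_i=U_{i+1}$ $(0\le i\le d-1)$, $(A-\theta_dI)U_d=0$, $(A^*-\theta^*_iI)U_i=U_{i-1}$ $(1\le i\le d)$, $(A^*-\theta^*_0I)U_0=0$. For $1\le i\le d$, $\varphi_i$ denotes the (nonzero) eigenvalue of $(A-\theta_{i-1}I)(A^*-\theta^*_iI)$ on $U_i$; $\varphi_1,\dots,\varphi_d$ is the first split sequence of $\Phi$. The sequence $\Phi^{\Downarrow}=(A;\{E_{d-i}\}_{i=0}^d;A^*;\{E^*_i\}_{i=0}^d)$ is also a Leonard system, and the second split sequence $\phi_1,\dots,\phi_d$ of $\Phi$ is the first split sequence of $\Phi^{\Downarrow}$; that is, $\phi_i$ is the (nonzero) eigenvalue of $(A-\theta_{d-i+1}I)(A^*-\theta^*_iI)$ on $(E^*_0V+\cdots+E^*_iV)\cap(E_{d-i}V+E_{d-i-1}V+\cdots+E_0V)$. The parameter array of $\Phi$ is $(\{\theta_i\}_{i=0}^d;\{\theta^*_i\}_{i=0}^d;\{\varphi_i\}_{i=1}^d;\{\phi_i\}_{i=1}^d)$.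 Polynomials. For $0\le i\le d$, in $\mathbb{K}[\lambda]$: $\tau_i=(\lambda-\theta_0)(\lambda-\theta_1)\cdots(\lambda-\theta_{i-1})$, $\eta_i=(\lambda-\theta_d)(\lambda-\theta_{d-1})\cdots(\lambda-\theta_{d-i+1})$, $\tau^*_i=(\lambda-\theta^*_0)(\lambda-\theta^*_1)\cdots(\lambda-\theta^*_{i-1})$, $\eta^*_i=(\lambda-\theta^*_d)(\lambda-\theta^*_{d-1})\cdots(\lambda-\theta^*_{d-i+1})$. *)

theory Defs
  imports "HOL-Computational_Algebra.Polynomial" "Jordan_Normal_Form.Matrix"
begin

text \<open>The algebra is a type \<open>'a\<close> of class \<^class>\<open>ring_1\<close> with a scalar multiplication.\<close>

locale K_algebra = vector_space scale
  for scale :: "'k::field \<Rightarrow> 'a::ring_1 \<Rightarrow> 'a" +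
  assumes scale_mult_left: "scale c x * y = scale c (x * y)"
    and scale_mult_right: "x * scale c y = scale c (x * y)"

definition isomorphic_to_Mat :: "('k::field \<Rightarrow> 'a::ring_1 \<Rightarrow> 'a) \<Rightarrow> nat \<Rightarrow> bool" where
  "isomorphic_to_Mat scale n \<longleftrightarrow>
    (\<exists>f :: 'a \<Rightarrow> 'k mat.
      bij_betw f UNIV (carrier_mat n n) \<and>
      f 1 = 1\<^sub>m n \<and>
      (\<forall>x y. f (x + y) = f x + f y) \<and>
      (\<forall>x y. f (x * y) = f x * f y) \<and>
      (\<forall>c x. f (scale c x) = c \<cdot>\<^sub>m f x))"

locale left_module =
  fixes act :: "'a::ring_1 \<Rightarrow> 'v::ab_group_add \<Rightarrow> 'v"
  assumes act_add_left: "act (x + y) v = act x v + act y v"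
    and act_add_right: "act x (v + w) = act x v + act x w"
    and act_mult: "act (x * y) v = act x (act y v)"
    and act_one: "act 1 v = v"

definition submodule :: "('a::ring_1 \<Rightarrow> 'v::ab_group_add \<Rightarrow> 'v) \<Rightarrow> 'v set \<Rightarrow> bool" where
  "submodule act W \<longleftrightarrow>
    0 \<in> W \<and> (\<forall>v\<in>W. \<forall>w\<in>W. v + w \<in> W) \<and> (\<forall>x. \<forall>w\<in>W. act x w \<in> W)"

locale simple_left_module = left_module act
  for act :: "'a::ring_1 \<Rightarrow> 'v::ab_group_add \<Rightarrow> 'v" +
  assumes nonzero: "\<exists>v::'v. v \<noteq> 0"
    and simple: "submodule act W \<Longrightarrow> W = {0} \<or> W = UNIV"

text \<open>The field acts on \<open>V\<close> through the algebra: \<open>c v = (c 1) v\<close>.\<close>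

definition eigenvalue_on ::
  "('k::field \<Rightarrow> 'a::ring_1 \<Rightarrow> 'a) \<Rightarrow> ('a \<Rightarrow> 'v::ab_group_add \<Rightarrow> 'v) \<Rightarrow> 'v set \<Rightarrow> 'a \<Rightarrow> 'k \<Rightarrow> bool" where
  "eigenvalue_on scale act W x c \<longleftrightarrow> (\<exists>w\<in>W. w \<noteq> 0 \<and> act x w = act (scale c 1) w)"

definition eigenvalues ::
  "('k::field \<Rightarrow> 'a::ring_1 \<Rightarrow> 'a) \<Rightarrow> ('a \<Rightarrow> 'v::ab_group_add \<Rightarrow> 'v) \<Rightarrow> 'a \<Rightarrow> 'k set" where
  "eigenvalues scale act x = {c. eigenvalue_on scale act UNIV x c}"

definition multiplicity_free ::
  "('k::field \<Rightarrow> 'a::ring_1 \<Rightarrow> 'a) \<Rightarrow> ('a \<Rightarrow> 'v::ab_group_add \<Rightarrow> 'v) \<Rightarrow> nat \<Rightarrow> 'a \<Rightarrow> bool" where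
  "multiplicity_free scale act d x \<longleftrightarrow> card (eigenvalues scale act x) = d + 1"

definition primitive_idempotent ::
  "('k::field \<Rightarrow> 'a::ring_1 \<Rightarrow> 'a) \<Rightarrow> nat \<Rightarrow> 'a \<Rightarrow> (nat \<Rightarrow> 'k) \<Rightarrow> nat \<Rightarrow> 'a" where
  "primitive_idempotent scale d x \<theta> i =
    prod_list (map (\<lambda>j. scale (1 / (\<theta> i - \<theta> j)) (x - scale (\<theta> j) 1))
      (filter (\<lambda>j. j \<noteq> i) [0..<d + 1]))"

text \<open>\<open>\<theta> 0, ..., \<theta> d\<close> is an ordering of the eigenvalues of \<open>x\<close>, and \<open>E i\<close> is the
  primitive idempotent of \<open>x\<close> associated with \<open>\<theta> i\<close>. Here and below, sequences are functions on
  \<^typ>\<open>nat\<close> whose values outside the relevant index range play no role.\<close>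

definition idempotents_for ::
  "('k::field \<Rightarrow> 'a::ring_1 \<Rightarrow> 'a) \<Rightarrow> ('a \<Rightarrow> 'v::ab_group_add \<Rightarrow> 'v) \<Rightarrow> nat \<Rightarrow>
    'a \<Rightarrow> (nat \<Rightarrow> 'a) \<Rightarrow> (nat \<Rightarrow> 'k) \<Rightarrow> bool" where
  "idempotents_for scale act d x E \<theta> \<longleftrightarrow>
    bij_betw \<theta> {0..d} (eigenvalues scale act x) \<and>
    (\<forall>i\<le>d. E i = primitive_idempotent scale d x \<theta> i)"

definition leonard_system ::
  "('k::field \<Rightarrow> 'a::ring_1 \<Rightarrow> 'a) \<Rightarrow> ('a \<Rightarrow> 'v::ab_group_add \<Rightarrow> 'v) \<Rightarrow> nat \<Rightarrow>
    'a \<Rightarrow> (nat \<Rightarrow> 'a) \<Rightarrow> 'a \<Rightarrow> (nat \<Rightarrow> 'a) \<Rightarrow> bool" where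
  "leonard_system scale act d A E As Es \<longleftrightarrow>
    multiplicity_free scale act d A \<and>
    multiplicity_free scale act d As \<and>
    (\<exists>\<theta>. idempotents_for scale act d A E \<theta>) \<and>
    (\<exists>\<theta>. idempotents_for scale act d As Es \<theta>) \<and>
    (\<forall>i\<le>d. \<forall>j\<le>d.
      (\<bar>int i - int j\<bar> > 1 \<longrightarrow> E i * As * E j = 0) \<and>
      (\<bar>int i - int j\<bar> = 1 \<longrightarrow> E i * As * E j \<noteq> 0)) \<and>
    (\<forall>i\<le>d. \<forall>j\<le>d.
      (\<bar>int i - int j\<bar> > 1 \<longrightarrow> Es i * A * Es j = 0) \<and>
      (\<bar>int i - int j\<bar> = 1 \<longrightarrow> Es i * A * Es j \<noteq> 0))"

text \<open>The sum of the subspaces \<open>(E h) V\<close> over \<open>h \<in> S\<close>.\<close>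

definition sum_of_images ::
  "('a::ring_1 \<Rightarrow> 'v::ab_group_add \<Rightarrow> 'v) \<Rightarrow> (nat \<Rightarrow> 'a) \<Rightarrow> nat set \<Rightarrow> 'v set" where
  "sum_of_images act E S = range (\<lambda>w. \<Sum>h\<in>S. act (E h) (w h))"

definition split_space ::
  "('a::ring_1 \<Rightarrow> 'v::ab_group_add \<Rightarrow> 'v) \<Rightarrow> nat \<Rightarrow> (nat \<Rightarrow> 'a) \<Rightarrow> (nat \<Rightarrow> 'a) \<Rightarrow> nat \<Rightarrow> 'v set" where
  "split_space act d E Es i = sum_of_images act Es {0..i} \<inter> sum_of_images act E {i..d}"

definition first_split_sequence ::
  "('k::field \<Rightarrow> 'a::ring_1 \<Rightarrow> 'a) \<Rightarrow> ('a \<Rightarrow> 'v::ab_group_add \<Rightarrow> 'v) \<Rightarrow> nat \<Rightarrow>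
    'a \<Rightarrow> (nat \<Rightarrow> 'a) \<Rightarrow> 'a \<Rightarrow> (nat \<Rightarrow> 'a) \<Rightarrow> (nat \<Rightarrow> 'k) \<Rightarrow> (nat \<Rightarrow> 'k) \<Rightarrow> (nat \<Rightarrow> 'k) \<Rightarrow> bool" where
  "first_split_sequence scale act d A E As Es \<theta> \<theta>s varphi \<longleftrightarrow>
    (\<forall>i\<in>{1..d}. eigenvalue_on scale act (split_space act d E Es i)
      ((A - scale (\<theta> (i - 1)) 1) * (As - scale (\<theta>s i) 1)) (varphi i))"

text \<open>The second split sequence is the first split sequence of the system obtained by
  reversing \<open>E 0, ..., E d\<close>, and hence \<open>\<theta> 0, ..., \<theta> d\<close>.\<close>

definition parameter_array ::
  "('k::field \<Rightarrow> 'a::ring_1 \<Rightarrow> 'a) \<Rightarrow> ('a \<Rightarrow> 'v::ab_group_add \<Rightarrow> 'v) \<Rightarrow> nat \<Rightarrow>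
    'a \<Rightarrow> (nat \<Rightarrow> 'a) \<Rightarrow> 'a \<Rightarrow> (nat \<Rightarrow> 'a) \<Rightarrow>
    (nat \<Rightarrow> 'k) \<Rightarrow> (nat \<Rightarrow> 'k) \<Rightarrow> (nat \<Rightarrow> 'k) \<Rightarrow> (nat \<Rightarrow> 'k) \<Rightarrow> bool" where
  "parameter_array scale act d A E As Es \<theta> \<theta>s varphi phi \<longleftrightarrow>
    idempotents_for scale act d A E \<theta> \<and>
    idempotents_for scale act d As Es \<theta>s \<and>
    first_split_sequence scale act d A E As Es \<theta> \<theta>s varphi \<and>
    first_split_sequence scale act d A (\<lambda>i. E (d - i)) As Es (\<lambda>i. \<theta> (d - i)) \<theta>s phi"

definition tau_poly :: "(nat \<Rightarrow> 'k::field) \<Rightarrow> nat \<Rightarrow> 'k poly" where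
  "tau_poly \<theta> i = (\<Prod>h<i. [:- \<theta> h, 1:])"

definition eta_poly :: "nat \<Rightarrow> (nat \<Rightarrow> 'k::field) \<Rightarrow> nat \<Rightarrow> 'k poly" where
  "eta_poly d \<theta> i = (\<Prod>h<i. [:- \<theta> (d - h), 1:])"

definition alg_poly :: "('k::field \<Rightarrow> 'a::ring_1 \<Rightarrow> 'a) \<Rightarrow> 'k poly \<Rightarrow> 'a \<Rightarrow> 'a" where
  "alg_poly scale p x = (\<Sum>j\<le>degree p. scale (coeff p j) (x ^ j))"

end

theory Submission
  imports Defs
begin

text \<open>
  Everything takes place on the simple module \<open>V\<close>, which is faithful of dimension \<open>d + 1\<close>. Both \<open>A\<close>
  and \<open>A\<^sup>*\<close> have an eigenbasis there, and each primitive idempotent projects onto one basis line.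

  Fix a generator \<open>u\<^sub>0\<close> of \<open>E\<^sup>*\<^sub>0 V\<close> and put \<open>u\<^sub>i = \<tau>\<^sub>i(A) u\<^sub>0\<close>. Irreducible tridiagonality of \<open>A\<close> on the
  eigenbasis of \<open>A\<^sup>*\<close> makes \<open>u\<^sub>0, ..., u\<^sub>d\<close> a basis of \<open>V\<close> that is triangular with respect to that
  eigenbasis, and \<open>u\<^sub>i\<close> spans the split space \<open>U\<^sub>i\<close> (lemma \<open>u_line\<close>). On this basis both operators are
  bidiagonal:
  \<open>A u\<^sub>i = \<theta>\<^sub>i u\<^sub>i + u\<^bsub>i+1\<^esub>\<close> and \<open>A\<^sup>* u\<^sub>i = \<theta>\<^sup>*\<^sub>i u\<^sub>i + \<phi>\<^sub>i u\<^bsub>i-1\<^esub>\<close> (lemmas \<open>A_u\<close> and \<open>As_u\<close>), where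
  \<open>\<phi>\<^sub>1, ..., \<phi>\<^sub>d\<close> is the first split sequence. Four of the eight identities follow from these two formulas.

  For \<open>E\<^sub>0 E\<^sup>*\<^sub>d \<eta>\<^sub>i(A)\<close> and \<open>E\<^sup>*\<^sub>d E\<^sub>0 \<tau>\<^sup>*\<^sub>i(A\<^sup>*)\<close> both sides are compared on each \<open>u\<^sub>j\<close>. The \<open>E\<^sub>0\<close>-coordinate
  vanishes on all \<open>u\<^sub>j\<close> except \<open>u\<^sub>0\<close> and the \<open>E\<^sup>*\<^sub>d\<close>-coordinate on all except \<open>u\<^sub>d\<close>; composed with
  \<open>\<tau>\<^sup>*\<^sub>k(A\<^sup>*)\<close> and \<open>\<eta>\<^sub>k(A)\<close> they become multiples of the members of the basis dual to the \<open>u\<^sub>j\<close>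
  (lemmas \<open>coord_tau_u\<close> and \<open>coord_eta_u\<close>), so that both sides are a multiple of the same dual vector.

  For \<open>E\<^sub>d E\<^sup>*\<^sub>0 \<tau>\<^sub>i(A)\<close> and \<open>E\<^sup>*\<^sub>0 E\<^sub>d \<eta>\<^sup>*\<^sub>i(A\<^sup>*)\<close> it is the identities with all factors in the opposite order
  that can be read off, because the rightmost factors then map onto the lines through \<open>u\<^sub>d\<close> and \<open>u\<^sub>0\<close>
  (lemmas \<open>tau_Es_0_E_d\<close> and \<open>eta_E_d_Es_0\<close>). The order is restored by transposition: an irreducible
  tridiagonal matrix becomes symmetric after rescaling the basis, so \<open>V\<close> carries a nondegenerate
  symmetric bilinear form for which \<open>A\<close> and \<open>A\<^sup>*\<close> are both self-adjoint.

  The other four identities are these four for the system in which \<open>E\<^sub>0, ..., E\<^sub>d\<close> is reversed: this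
  exchanges \<open>\<tau>\<^sub>i\<close> with \<open>\<eta>\<^sub>i\<close>, and the first split sequence of the reversed system is by definition the
  second split sequence of the given one.
\<close>

section \<open>Polynomials in an algebra element\<close>

context K_algebra
begin

lemma alg_poly_0 [simp]: "alg_poly scale 0 x = 0"
  by (simp add: alg_poly_def)

lemma alg_poly_pCons: "alg_poly scale (pCons a p) x = scale a 1 + x * alg_poly scale p x"
proof (cases "p = 0")
  case False
  have "alg_poly scale (pCons a p) x = scale a 1 + (\<Sum>j\<le>degree p. scale (coeff p j) (x ^ Suc j))"
    using False by (simp add: alg_poly_def sum.atMost_Suc_shift del: sum.atMost_Suc)
  then show ?thesis
    by (simp add: alg_poly_def sum_distrib_left scale_mult_right)
qed (simp add: alg_poly_def)

lemma alg_poly_add: "alg_poly scale (p + q) x = alg_poly scale p x + alg_poly scale q x"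
  by (induction p q rule: poly_induct2)
    (simp_all add: alg_poly_pCons scale_left_distrib algebra_simps)

lemma alg_poly_smult: "alg_poly scale (Polynomial.smult a p) x = scale a (alg_poly scale p x)"
  by (induction p)
    (simp_all add: alg_poly_pCons scale_right_distrib scale_mult_right)

lemma alg_poly_mult: "alg_poly scale (p * q) x = alg_poly scale p x * alg_poly scale q x"
  by (induction p)
    (simp_all add: alg_poly_pCons alg_poly_add alg_poly_smult scale_mult_left algebra_simps)

lemma alg_poly_linear: "alg_poly scale [:- a, 1:] x = x - scale a 1"
  by (simp add: alg_poly_pCons)

lemma alg_poly_1 [simp]: "alg_poly scale 1 x = 1"
  by (simp add: one_pCons alg_poly_pCons)

end

lemma tau_poly_0 [simp]: "tau_poly \<theta> 0 = 1"
  by (simp add: tau_poly_def)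

lemma tau_poly_Suc: "tau_poly \<theta> (Suc i) = tau_poly \<theta> i * [:- \<theta> i, 1:]"
  by (simp add: tau_poly_def)

lemma eta_poly_0 [simp]: "eta_poly d \<theta> 0 = 1"
  by (simp add: eta_poly_def)

lemma eta_poly_Suc: "eta_poly d \<theta> (Suc i) = eta_poly d \<theta> i * [:- \<theta> (d - i), 1:]"
  by (simp add: eta_poly_def)

lemma tau_poly_rev: "tau_poly (\<lambda>i. \<theta> (d - i)) i = eta_poly d \<theta> i"
  by (simp add: tau_poly_def eta_poly_def)

lemma eta_poly_rev: "i \<le> d \<Longrightarrow> eta_poly d (\<lambda>i. \<theta> (d - i)) i = tau_poly \<theta> i"
  by (auto simp: tau_poly_def eta_poly_def intro!: prod.cong)

lemma poly_tau: "poly (tau_poly \<theta> i) z = (\<Prod>h<i. z - \<theta> h)"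
  by (simp add: tau_poly_def poly_prod)

lemma poly_eta: "poly (eta_poly d \<theta> i) z = (\<Prod>h<i. z - \<theta> (d - h))"
  by (simp add: eta_poly_def poly_prod)


section \<open>Modules over an algebra\<close>

context left_module
begin

lemma act_0_left [simp]: "act 0 v = 0"
  using act_add_left[of 0 0 v] by simp

lemma act_0_right [simp]: "act x 0 = 0"
  using act_add_right[of x 0 0] by simp

lemma act_minus_left: "act (- x) v = - act x v"
  using act_add_left[of x "- x" v] by (simp add: eq_neg_iff_add_eq_0 add.commute)

lemma act_diff_left: "act (x - y) v = act x v - act y v"
  using act_add_left[of x "- y" v] by (simp add: act_minus_left)

lemma act_minus_right: "act x (- v) = - act x v"
  using act_add_right[of x v "- v"] by (simp add: eq_neg_iff_add_eq_0 add.commute)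

lemma act_diff_right: "act x (v - w) = act x v - act x w"
  using act_add_right[of x v "- w"] by (simp add: act_minus_right)

lemma act_sum_right: "act x (\<Sum>i\<in>I. f i) = (\<Sum>i\<in>I. act x (f i))"
  by (induction I rule: infinite_finite_induct) (simp_all add: act_add_right)

lemma act_sum_left: "act (\<Sum>i\<in>I. f i) v = (\<Sum>i\<in>I. act (f i) v)"
  by (induction I rule: infinite_finite_induct) (simp_all add: act_add_left)

end

locale algebra_module = K_algebra scale + left_module act
  for scale :: "'k::field \<Rightarrow> 'a::ring_1 \<Rightarrow> 'a" and act :: "'a \<Rightarrow> 'v::ab_group_add \<Rightarrow> 'v"
begin

definition smul :: "'k \<Rightarrow> 'v \<Rightarrow> 'v" (infixr "\<cdot>" 75) where
  "c \<cdot> v = act (scale c 1) v"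

lemma act_scale: "act (scale c x) v = c \<cdot> act x v"
  by (simp add: smul_def act_mult[symmetric] scale_mult_left)

lemma act_smul: "act x (c \<cdot> v) = c \<cdot> act x v"
  by (simp add: smul_def act_mult[symmetric] scale_mult_left scale_mult_right)

sublocale V: vector_space smul
proof
  show "a \<cdot> b \<cdot> x = (a * b) \<cdot> x" for a b x
    by (simp add: smul_def act_mult[symmetric] scale_mult_left)
qed (simp_all add: smul_def act_add_right act_add_left act_one scale_left_distrib)

lemma act_linear_factor: "act (x - scale a 1) v = act x v - a \<cdot> v"
  by (simp add: act_diff_left act_scale act_one)

lemma act_alg_poly_eigen:
  assumes "act x w = \<mu> \<cdot> w"
  shows "act (alg_poly scale p x) w = poly p \<mu> \<cdot> w"
proof (induction p)
  case (pCons a p)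
  have "act (alg_poly scale (pCons a p) x) w = a \<cdot> w + act x (poly p \<mu> \<cdot> w)"
    by (simp add: alg_poly_pCons act_add_left act_mult act_scale act_one pCons.IH)
  then show ?case
    by (simp add: act_smul assms V.scale_left_distrib mult.commute)
qed simp

text \<open>On an eigenvector every factor of the primitive idempotent is a scalar, so the idempotent acts as
  the Lagrange interpolation polynomial evaluated at the eigenvalue.\<close>

lemma act_primitive_idempotent_eigen:
  assumes "act x w = \<mu> \<cdot> w"
  shows "act (primitive_idempotent scale d x \<theta> i) w =
    (\<Prod>j\<in>{..d} - {i}. (\<mu> - \<theta> j) / (\<theta> i - \<theta> j)) \<cdot> w"
proof -
  have "act (prod_list (map (\<lambda>j. scale (1 / (\<theta> i - \<theta> j)) (x - scale (\<theta> j) 1)) js)) w =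
      prod_list (map (\<lambda>j. (\<mu> - \<theta> j) / (\<theta> i - \<theta> j)) js) \<cdot> w" for js
    by (induction js)
      (simp_all add: act_one act_mult act_scale act_smul act_linear_factor assms
        V.scale_left_diff_distrib[symmetric] mult.commute)
  moreover have "prod_list (map f (filter (\<lambda>j. j \<noteq> i) [0..<d + 1])) =
      (\<Prod>j\<in>{..d} - {i}. f j)" for f :: "nat \<Rightarrow> 'k"
  proof -
    have "set (filter (\<lambda>j. j \<noteq> i) [0..<d + 1]) = {..d} - {i}"
      by auto
    then show ?thesis
      using prod.distinct_set_conv_list[of "filter (\<lambda>j. j \<noteq> i) [0..<d + 1]" f] by simp
  qed
  ultimately show ?thesis
    by (simp only: primitive_idempotent_def)
qed

end

section \<open>Eigenbases and their idempotents\<close>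

text \<open>The data of a multiplicity-free element in coordinates: \<open>c i\<close> is the linear functional dual to
  the eigenvector \<open>v i\<close>, and \<open>E i\<close> is the projection \<open>w \<mapsto> c i w \<cdot> v i\<close>. Linearity of \<open>c i\<close> is a
  consequence, since \<open>E i\<close> acts linearly and \<open>v i\<close> is nonzero.\<close>

locale eigenbasis = algebra_module scale act
  for scale :: "'k::field \<Rightarrow> 'a::ring_1 \<Rightarrow> 'a" and act :: "'a \<Rightarrow> 'v::ab_group_add \<Rightarrow> 'v" +
  fixes d :: nat and x :: 'a and E :: "nat \<Rightarrow> 'a" and \<theta> :: "nat \<Rightarrow> 'k"
    and v :: "nat \<Rightarrow> 'v" and c :: "nat \<Rightarrow> 'v \<Rightarrow> 'k"
  assumes eigenvalues_distinct: "inj_on \<theta> {..d}"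
    and act_eigenvector: "i \<le> d \<Longrightarrow> act x (v i) = \<theta> i \<cdot> v i"
    and act_idempotent: "i \<le> d \<Longrightarrow> act (E i) w = c i w \<cdot> v i"
    and expansion: "w = (\<Sum>i\<le>d. c i w \<cdot> v i)"
    and eigenvector_nonzero: "i \<le> d \<Longrightarrow> v i \<noteq> 0"
    and coord_basis: "i \<le> d \<Longrightarrow> j \<le> d \<Longrightarrow> c i (v j) = (if i = j then 1 else 0)"
begin

lemma coord_add: "i \<le> d \<Longrightarrow> c i (w + w') = c i w + c i w'"
  using act_add_right[of "E i" w w'] eigenvector_nonzero[of i]
  by (simp add: act_idempotent V.scale_left_distrib[symmetric])

lemma coord_smul: "i \<le> d \<Longrightarrow> c i (a \<cdot> w) = a * c i w"
  using act_smul[of "E i" a w] eigenvector_nonzero[of i]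
  by (simp add: act_idempotent)

lemma coord_0: "i \<le> d \<Longrightarrow> c i 0 = 0"
  using coord_smul[of i 0 0] by simp

lemma coord_diff: "i \<le> d \<Longrightarrow> c i (w - w') = c i w - c i w'"
  using coord_add[of i "w - w'" w'] by simp

lemma coord_sum: "i \<le> d \<Longrightarrow> c i (\<Sum>k\<in>K. f k) = (\<Sum>k\<in>K. c i (f k))"
  by (induction K rule: infinite_finite_induct) (simp_all add: coord_0 coord_add)

lemma coord_eqI:
  assumes "\<And>i. i \<le> d \<Longrightarrow> c i w = c i w'"
  shows "w = w'"
proof -
  have "(\<Sum>i\<le>d. c i w \<cdot> v i) = (\<Sum>i\<le>d. c i w' \<cdot> v i)"
    using assms by simp
  then show ?thesis
    using expansion[of w] expansion[of w'] by argo
qed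

lemma coord_act: 
  assumes "j \<le> d"
  shows "c j (act y w) = (\<Sum>k\<le>d. c k w * c j (act y (v k)))"
proof -
  have "c j (act y w) = c j (act y (\<Sum>k\<le>d. c k w \<cdot> v k))"
    using expansion[of w] by (rule arg_cong)
  then show ?thesis
    using assms by (simp add: act_sum_right coord_sum act_smul coord_smul)
qed

lemma coord_alg_poly:
  assumes "j \<le> d"
  shows "c j (act (alg_poly scale p x) w) = poly p (\<theta> j) * c j w"
proof -
  have "c j (act (alg_poly scale p x) w) = (\<Sum>k\<le>d. c k w * (poly p (\<theta> k) * c j (v k)))"
    by (subst coord_act[OF assms], intro sum.cong) (simp_all add: assms act_alg_poly_eigen[OF act_eigenvector] coord_smul)
  also have "\<dots> = (\<Sum>k\<le>d. if k = j then c k w * poly p (\<theta> k) else 0)"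
    by (intro sum.cong) (auto simp: coord_basis assms)
  finally show ?thesis
    using assms by simp
qed

lemma coord_x: "j \<le> d \<Longrightarrow> c j (act x w) = \<theta> j * c j w"
  using coord_alg_poly[of j "[:0, 1:]" w] by (simp add: alg_poly_pCons)

lemma coord_idempotent: "j \<le> d \<Longrightarrow> i \<le> d \<Longrightarrow> c j (act (E i) w) = (if i = j then c i w else 0)"
  by (simp add: act_idempotent coord_smul coord_basis)

text \<open>A polynomial that vanishes at all eigenvalues but one kills all eigenvectors but one. The two
  instances below turn the extreme idempotents into multiples of \<open>\<tau>\<^sub>d\<close> and \<open>\<eta>\<^sub>d\<close>, which can be
  applied one linear factor at a time.\<close>

lemma act_alg_poly_isolating:
  assumes "i \<le> d" "\<And>j. j \<le> d \<Longrightarrow> j \<noteq> i \<Longrightarrow> poly p (\<theta> j) = 0"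
  shows "act (alg_poly scale p x) w = poly p (\<theta> i) \<cdot> act (E i) w"
  using assms by (intro coord_eqI) (auto simp: coord_alg_poly coord_smul coord_idempotent)

lemma act_tau_last: "act (alg_poly scale (tau_poly \<theta> d) x) w = poly (tau_poly \<theta> d) (\<theta> d) \<cdot> act (E d) w"
  by (rule act_alg_poly_isolating) (auto simp: poly_tau)

lemma act_eta_first: "act (alg_poly scale (eta_poly d \<theta> d) x) w = poly (eta_poly d \<theta> d) (\<theta> 0) \<cdot> act (E 0) w"
proof (rule act_alg_poly_isolating)
  fix j assume "j \<le> d" "j \<noteq> 0"
  then show "poly (eta_poly d \<theta> d) (\<theta> j) = 0"
    by (auto simp: poly_eta intro!: bexI[of _ "d - j"])
qed simp

lemma tau_nonzero: "i \<le> j \<Longrightarrow> j \<le> d \<Longrightarrow> poly (tau_poly \<theta> i) (\<theta> j) \<noteq> 0"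
  using eigenvalues_distinct by (auto simp: poly_tau dest: inj_onD)

lemma tau_zero: "j < i \<Longrightarrow> poly (tau_poly \<theta> i) (\<theta> j) = 0"
  by (auto simp: poly_tau)

lemma eta_nonzero: "poly (eta_poly d \<theta> d) (\<theta> 0) \<noteq> 0"
proof -
  have "\<theta> 0 \<noteq> \<theta> (d - h)" if "h < d" for h
    using inj_onD[OF eigenvalues_distinct, of 0 "d - h"] that by auto
  then show ?thesis
    by (auto simp: poly_eta)
qed

lemma eigenbasis_rev:
  "eigenbasis scale act d x (\<lambda>i. E (d - i)) (\<lambda>i. \<theta> (d - i)) (\<lambda>i. v (d - i)) (\<lambda>i. c (d - i))"
proof
  show "inj_on (\<lambda>i. \<theta> (d - i)) {..d}"
    by (rule inj_onI) (use inj_onD[OF eigenvalues_distinct] in force)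
  show "w = (\<Sum>i\<le>d. c (d - i) w \<cdot> v (d - i))" for w
  proof -
    have "(\<Sum>i\<le>d. c i w \<cdot> v i) = (\<Sum>i\<le>d. c (d - i) w \<cdot> v (d - i))"
      using sum.nat_diff_reindex[of "\<lambda>i. c i w \<cdot> v i" "Suc d"] by (simp add: lessThan_Suc_atMost)
    with expansion[of w] show ?thesis
      by (rule trans)
  qed
qed (auto simp: act_eigenvector act_idempotent coord_basis eigenvector_nonzero)

end

section \<open>Dimension and faithfulness of the simple module\<close>

text \<open>Matrix units and the entries of an element with respect to them carry the whole content of the
  isomorphism with the matrix algebra, and allow calculation inside the algebra itself.\<close>

lemma matrix_units:
  fixes scale :: "'k::field \<Rightarrow> 'a::ring_1 \<Rightarrow> 'a"
  assumes "isomorphic_to_Mat scale n"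
  obtains e :: "nat \<Rightarrow> nat \<Rightarrow> 'a" and m :: "'a \<Rightarrow> nat \<Rightarrow> nat \<Rightarrow> 'k" where
    "\<And>i j k l. i < n \<Longrightarrow> j < n \<Longrightarrow> k < n \<Longrightarrow> l < n \<Longrightarrow> e i j * e k l = (if j = k then e i l else 0)"
    "(\<Sum>i<n. e i i) = 1"
    "\<And>x. x = (\<Sum>i<n. \<Sum>j<n. scale (m x i j) (e i j))"
proof -
  obtain f :: "'a \<Rightarrow> 'k mat" where f: "bij_betw f UNIV (carrier_mat n n)"
    and f_1: "f 1 = 1\<^sub>m n"
    and f_add: "\<And>x y. f (x + y) = f x + f y"
    and f_mult: "\<And>x y. f (x * y) = f x * f y"
    and f_scale: "\<And>c x. f (scale c x) = c \<cdot>\<^sub>m f x"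
    using assms unfolding isomorphic_to_Mat_def by auto
  have carrier: "f x \<in> carrier_mat n n" for x
    using f by (auto simp: bij_betw_def)
  define g where "g = inv_into UNIV f"
  have g: "f (g M) = M" if "M \<in> carrier_mat n n" for M
    using f that by (simp add: g_def bij_betw_def f_inv_into_f)
  define m where "m x i j = f x $$ (i, j)" for x i j
  define e where "e i j = g (mat n n (\<lambda>(a, b). if a = i \<and> b = j then 1 else 0))" for i j
  have dims [simp]: "dim_row (f x) = n" "dim_col (f x) = n" for x
    using carrier[of x] by auto
  have m_eqI: "x = y" if "\<And>a b. a < n \<Longrightarrow> b < n \<Longrightarrow> m x a b = m y a b" for x y
  proof -
    have "f x = f y"
      using that by (intro eq_matI) (auto simp: m_def)
    then show ?thesis
      using f by (auto simp: bij_betw_def dest: injD)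
  qed
  have m_add: "m (x + y) a b = m x a b + m y a b" if "a < n" "b < n" for x y a b
    using that by (simp add: m_def f_add)
  have m_0: "m 0 a b = 0" if "a < n" "b < n" for a b
    using m_add[OF that, of 0 0] unfolding add_0_left by (metis add_cancel_left_left)
  have m_sum: "m (sum g I) a b = (\<Sum>i\<in>I. m (g i) a b)" if "a < n" "b < n" for g :: "nat \<Rightarrow> 'a" and I a b
    by (induction I rule: infinite_finite_induct) (simp_all add: m_0 m_add that)
  have m_scale: "m (scale c x) a b = c * m x a b" if "a < n" "b < n" for c x a b
    using that by (simp add: m_def f_scale)
  have m_mult: "m (x * y) a b = (\<Sum>k<n. m x a k * m y k b)" if "a < n" "b < n" for x y a b
    using that by (simp add: m_def f_mult scalar_prod_def atLeast0LessThan)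
  have m_1: "m 1 a b = (if a = b then 1 else 0)" if "a < n" "b < n" for a b
    using that by (simp add: m_def f_1)
  have m_e: "m (e i j) a b = (if a = i \<and> b = j then 1 else 0)" if "a < n" "b < n" for i j a b
    using that by (simp add: m_def e_def g)
  show ?thesis
  proof
    fix i j k l assume "i < n" "j < n" "k < n" "l < n"
    then show "e i j * e k l = (if j = k then e i l else 0)"
      by (intro m_eqI) (auto simp: m_mult m_e m_0 if_distrib[of "\<lambda>z. z * _"] cong: if_cong)
  next
    have "m (\<Sum>i<n. e i i) a b = m 1 a b" if "a < n" "b < n" for a b
    proof -
      have "m (\<Sum>i<n. e i i) a b = (\<Sum>i<n. if a = i then if a = b then 1 else 0 else 0)"
        unfolding m_sum[OF that] by (intro sum.cong) (auto simp: m_e that)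
      then show ?thesis
        using that by (simp add: m_1)
    qed
    then show "(\<Sum>i<n. e i i) = 1"
      by (rule m_eqI)
  next
    fix x
    have "m (\<Sum>i<n. \<Sum>j<n. scale (m x i j) (e i j)) a b = m x a b" if "a < n" "b < n" for a b
    proof -
      have "m (\<Sum>i<n. \<Sum>j<n. scale (m x i j) (e i j)) a b =
          (\<Sum>i<n. \<Sum>j<n. if j = b then if i = a then m x i j else 0 else 0)"
        unfolding m_sum[OF that] by (intro sum.cong) (auto simp: m_scale m_e that)
      then show ?thesis
        using that by simp
    qed
    then show "x = (\<Sum>i<n. \<Sum>j<n. scale (m x i j) (e i j))"
      by (intro m_eqI) simp
  qed
qed

text \<open>If \<open>e\<^sub>l\<^sub>l v \<noteq> 0\<close>, then the vectors \<open>e\<^sub>i\<^sub>l v\<close> span a nonzero submodule, hence all of \<open>V\<close>.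
  This bounds the dimension from above; \<open>d + 1\<close> distinct eigenvalues will bound it from below.
  An element \<open>x\<close> with a nonzero matrix entry cannot act as zero, because multiplying \<open>x\<close> by matrix
  units on both sides yields a nonzero multiple of \<open>e\<^sub>l\<^sub>l\<close>.\<close>

lemma (in algebra_module) spanned_and_faithful:
  assumes "isomorphic_to_Mat scale n" and "simple_left_module act"
  obtains S where "finite S" "card S \<le> n" "V.span S = UNIV"
    "\<And>x. (\<And>v. act x v = 0) \<Longrightarrow> x = 0"
proof -
  interpret simple_left_module act by fact
  obtain e :: "nat \<Rightarrow> nat \<Rightarrow> 'a" and m :: "'a \<Rightarrow> nat \<Rightarrow> nat \<Rightarrow> 'k" where
    e_mult: "\<And>i j k l. i < n \<Longrightarrow> j < n \<Longrightarrow> k < n \<Longrightarrow> l < n \<Longrightarrow> e i j * e k l = (if j = k then e i l else 0)"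
    and e_sum: "(\<Sum>i<n. e i i) = 1"
    and m: "\<And>x. x = (\<Sum>i<n. \<Sum>j<n. scale (m x i j) (e i j))"
    using matrix_units[OF assms(1)] by blast
  obtain v :: 'v where v: "v \<noteq> 0"
    using nonzero by blast
  have "(\<Sum>i<n. act (e i i) v) = v"
    using act_sum_left[of "\<lambda>i. e i i" "{..<n}" v] by (simp add: e_sum act_one)
  then have "\<not> (\<forall>l\<in>{..<n}. act (e l l) v = 0)"
    using v sum.neutral[of "{..<n}" "\<lambda>l. act (e l l) v"] by argo
  then obtain l where l: "l < n" "act (e l l) v \<noteq> 0"
    by auto
  define S where "S = (\<lambda>i. act (e i l) v) ` {..<n}"
  have S_span: "act (e i l) v \<in> V.span S" if "i < n" for i
    using that by (auto simp: S_def intro: V.span_base)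
  have "submodule act (V.span S)"
    unfolding submodule_def
  proof (intro conjI ballI allI)
    fix x w assume "w \<in> V.span S"
    then show "act x w \<in> V.span S"
    proof (induction rule: V.span_induct_alt)
      case base
      then show ?case by (simp add: V.span_zero)
    next
      case (step c s w)
      obtain k where k: "k < n" "s = act (e k l) v"
        using step.hyps by (auto simp: S_def)
      have "act x s \<in> V.span S"
        unfolding k(2)
      proof (subst m[of x])
        have "act (scale (m x i j) (e i j)) (act (e k l) v) \<in> V.span S" if "i < n" "j < n" for i j
          using that k l by (auto simp: act_scale act_mult[symmetric] scale_mult_left e_mult
              intro!: V.span_scale V.span_zero S_span)
        then show "act (\<Sum>i<n. \<Sum>j<n. scale (m x i j) (e i j)) (act (e k l) v) \<in> V.span S"
          by (auto simp: act_sum_left intro!: V.span_sum)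
      qed
      then show ?case
        using step by (auto simp: act_add_right act_smul intro: V.span_add V.span_scale)
    qed
  qed (auto intro: V.span_zero V.span_add)
  moreover have "act (e l l) v \<in> V.span S"
    using l by (intro S_span)
  ultimately have "V.span S = UNIV"
    using simple l by blast
  moreover have "x = 0" if x: "\<And>v. act x v = 0" for x
  proof -
    have "m x k j = 0" if "k < n" "j < n" for k j
    proof (rule ccontr)
      assume nz: "m x k j \<noteq> 0"
      have "e i k * x * e j i = scale (m x k j) (e i i)" if "i < n" for i
      proof -
        have "e i k * x * e j i =
            (\<Sum>a<n. \<Sum>b<n. scale (m x a b) (e i k * e a b * e j i))"
          by (subst m[of x]) (simp add: sum_distrib_left sum_distrib_right
              scale_mult_left scale_mult_right mult.assoc)
        also have "\<dots> = (\<Sum>a<n. \<Sum>b<n. if b = j then if a = k then scale (m x a b) (e i i) else 0 else 0)"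
          by (intro sum.cong refl) (use \<open>i < n\<close> \<open>k < n\<close> \<open>j < n\<close> in \<open>auto simp: e_mult\<close>)
        also have "\<dots> = scale (m x k j) (e i i)"
          using \<open>k < n\<close> \<open>j < n\<close> by simp
        finally show ?thesis .
      qed
      then have "m x k j \<cdot> act (e l l) v = act (e l k * x * e j l) v"
        using l(1) by (simp add: act_scale)
      then show False
        using nz l by (simp add: act_mult x)
    qed
    then show ?thesis
      by (subst m[of x]) simp
  qed
  moreover have "finite S" "card S \<le> n"
    using card_image_le[of "{..<n}" "\<lambda>i. act (e i l) v"] by (auto simp: S_def)
  ultimately show ?thesis
    using that by blast
qed

text \<open>The idempotents separate the \<open>d + 1\<close> eigenvectors, which are therefore linearly independent. In a
  space of dimension at most \<open>d + 1\<close> they form a basis.\<close>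

lemma (in algebra_module) eigenbasis_exists:
  assumes S: "finite S" "card S \<le> d + 1" "V.span S = UNIV"
    and E: "idempotents_for scale act d x E \<theta>"
  obtains v c where "eigenbasis scale act d x E \<theta> v c"
proof -
  have bij: "bij_betw \<theta> {0..d} (eigenvalues scale act x)"
    and E_eq: "\<And>i. i \<le> d \<Longrightarrow> E i = primitive_idempotent scale d x \<theta> i"
    using E by (auto simp: idempotents_for_def)
  have inj: "inj_on \<theta> {..d}"
    using bij by (simp add: bij_betw_def atMost_atLeast0)
  have "\<forall>i\<in>{..d}. \<exists>w. w \<noteq> 0 \<and> act x w = \<theta> i \<cdot> w"
    using bij by (force simp: bij_betw_def eigenvalues_def eigenvalue_on_def smul_def)
  then obtain v where v: "\<And>i. i \<le> d \<Longrightarrow> v i \<noteq> 0" "\<And>i. i \<le> d \<Longrightarrow> act x (v i) = \<theta> i \<cdot> v i"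
    by (metis atMost_iff)
  have E_v: "act (E i) (v j) = (if i = j then v j else 0)" if "i \<le> d" "j \<le> d" for i j
  proof -
    have "\<theta> i \<noteq> \<theta> h" if "h \<in> {..d} - {i}" for h
      using inj_onD[OF inj, of i h] that \<open>i \<le> d\<close> by auto
    then have "(\<Prod>h\<in>{..d} - {i}. (\<theta> i - \<theta> h) / (\<theta> i - \<theta> h)) = 1"
      by (intro prod.neutral) auto
    moreover have "(\<Prod>h\<in>{..d} - {i}. (\<theta> j - \<theta> h) / (\<theta> i - \<theta> h)) = 0" if "i \<noteq> j"
      using \<open>j \<le> d\<close> that by (intro prod_zero) (auto intro!: bexI[of _ j])
    ultimately have "(\<Prod>h\<in>{..d} - {i}. (\<theta> j - \<theta> h) / (\<theta> i - \<theta> h)) = (if i = j then 1 else 0)"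
      by auto
    then show ?thesis
      using act_primitive_idempotent_eigen[OF v(2)[OF that(2)], of d \<theta> i] that by (simp add: E_eq)
  qed
  have E_sum: "act (E i) (\<Sum>j\<le>d. t j \<cdot> v j) = t i \<cdot> v i" if "i \<le> d" for t i
  proof -
    have "act (E i) (\<Sum>j\<le>d. t j \<cdot> v j) = (\<Sum>j\<le>d. if i = j then t j \<cdot> v j else 0)"
      unfolding act_sum_right act_smul
      by (intro sum.cong refl) (use that in \<open>auto simp: E_v\<close>)
    then show ?thesis
      using that by simp
  qed
  have v_inj: "inj_on v {..d}"
    by (rule inj_onI) (metis E_v atMost_iff v(1))
  have card_v: "card (v ` {..d}) = d + 1"
    using v_inj by (simp add: card_image)
  have indep: "V.independent (v ` {..d})"
  proof
    assume "V.dependent (v ` {..d})"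
    then obtain u i where "i \<le> d" "u (v i) \<noteq> 0" "(\<Sum>w\<in>v ` {..d}. u w \<cdot> w) = 0"
      by (auto simp: V.dependent_finite)
    then show False
      using E_sum[of i "\<lambda>i. u (v i)"] v(1) by (simp add: sum.reindex[OF v_inj])
  qed
  have "V.span (v ` {..d}) = UNIV"
  proof (rule ccontr)
    assume "V.span (v ` {..d}) \<noteq> UNIV"
    then obtain w where w: "w \<notin> V.span (v ` {..d})"
      by blast
    then have "V.independent (insert w (v ` {..d}))" "w \<notin> v ` {..d}"
      using indep by (auto simp: V.independent_insert intro: V.span_base)
    moreover have "card T \<le> d + 1" if "V.independent T" for T
      using V.independent_span_bound[OF S(1) that] S by auto
    ultimately show False
      using card_v by fastforce
  qed
  then have "\<exists>t. w = (\<Sum>i\<le>d. t i \<cdot> v i)" for w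
    using V.span_finite[of "v ` {..d}"] by (force simp: sum.reindex[OF v_inj])
  then obtain c where c: "\<And>w. w = (\<Sum>i\<le>d. c w i \<cdot> v i)"
    by metis
  have act_E: "act (E i) w = c w i \<cdot> v i" if "i \<le> d" for i w
    using arg_cong[OF c[of w], of "act (E i)"] E_sum[OF that, of "c w"] by (rule trans)
  have "eigenbasis scale act d x E \<theta> v (\<lambda>i w. c w i)"
  proof
    show "w = (\<Sum>i\<le>d. c w i \<cdot> v i)" for w by (fact c)
    show "c (v j) i = (if i = j then 1 else 0)" if "i \<le> d" "j \<le> d" for i j
      using act_E[of i "v j"] E_v[of i j] v(1)[of i] that
      by (auto simp: V.scale_cancel_right dest: V.scale_right_imp_eq[of _ "c (v j) j" 1])
  qed (use inj v act_E in auto)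
  then show ?thesis
    using that by blast
qed

section \<open>The split basis\<close>

text \<open>The element \<open>E i * y * E j\<close> carries exactly one matrix entry of \<open>y\<close> in the eigenbasis; this
  translates the conditions on products of idempotents into conditions on matrix entries.\<close>

lemma (in eigenbasis) act_sandwich:
  assumes "i \<le> d" "j \<le> d"
  shows "act (E i * y * E j) w = (c j w * c i (act y (v j))) \<cdot> v i"
  using assms by (simp add: act_mult act_idempotent act_smul coord_smul)

lemma prod_split_nat:
  fixes f :: "nat \<Rightarrow> 'k::comm_monoid_mult"
  assumes "k \<le> n"
  shows "(\<Prod>h=1..n. f h) = (\<Prod>h=1..k. f h) * (\<Prod>h=k + 1..n. f h)"
  using prod.ub_add_nat[of 1 k f "n - k"] assms by simp

text \<open>What remains of a Leonard system once eigenbases are chosen. The sequence \<open>\<phi>\<close> is the first split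
  sequence of the ordering at hand; using the locale for both \<open>E 0, ..., E d\<close> and its reversal covers both
  split sequences.\<close>

locale split_system = algebra_module scale act +
  a: eigenbasis scale act d A E \<theta> v c + s: eigenbasis scale act d As Es \<theta>s vs cs
  for scale :: "'k::field \<Rightarrow> 'a::ring_1 \<Rightarrow> 'a" and act :: "'a \<Rightarrow> 'v::ab_group_add \<Rightarrow> 'v"
    and d A E \<theta> v c As Es \<theta>s vs cs +
  fixes \<phi> :: "nat \<Rightarrow> 'k"
  assumes faithful: "(\<And>w. act x w = 0) \<Longrightarrow> x = 0"
    and Es_A_Es_zero: "i \<le> d \<Longrightarrow> j \<le> d \<Longrightarrow> \<bar>int i - int j\<bar> > 1 \<Longrightarrow> Es i * A * Es j = 0"
    and Es_A_Es_nonzero: "i \<le> d \<Longrightarrow> j \<le> d \<Longrightarrow> \<bar>int i - int j\<bar> = 1 \<Longrightarrow> Es i * A * Es j \<noteq> 0"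
    and E_As_E_zero: "i \<le> d \<Longrightarrow> j \<le> d \<Longrightarrow> \<bar>int i - int j\<bar> > 1 \<Longrightarrow> E i * As * E j = 0"
    and split_eigenvalue: "i \<in> {1..d} \<Longrightarrow> eigenvalue_on scale act (split_space act d E Es i)
      ((A - scale (\<theta> (i - 1)) 1) * (As - scale (\<theta>s i) 1)) (\<phi> i)"
begin

lemma A_tridiagonal:
  assumes "i \<le> d" "j \<le> d" "\<bar>int i - int j\<bar> > 1"
  shows "cs i (act A (vs j)) = 0"
  using s.act_sandwich[of i j A "vs j"] Es_A_Es_zero[of i j] assms
  by (simp add: s.coord_basis s.eigenvector_nonzero)

lemma A_irreducible:
  assumes "i \<le> d" "j \<le> d" "\<bar>int i - int j\<bar> = 1"
  shows "cs i (act A (vs j)) \<noteq> 0"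
proof
  assume "cs i (act A (vs j)) = 0"
  then have "Es i * A * Es j = 0"
    using assms by (intro faithful) (simp add: s.act_sandwich)
  then show False
    using Es_A_Es_nonzero assms by blast
qed

lemma As_tridiagonal:
  assumes "i \<le> d" "j \<le> d" "\<bar>int i - int j\<bar> > 1"
  shows "c i (act As (v j)) = 0"
  using a.act_sandwich[of i j As "v j"] E_As_E_zero[of i j] assms
  by (simp add: a.coord_basis a.eigenvector_nonzero)

definition u :: "nat \<Rightarrow> 'v" where
  "u i = act (alg_poly scale (tau_poly \<theta> i) A) (vs 0)"

lemma u_0: "u 0 = vs 0"
  by (simp add: u_def act_one)

lemma A_u: "act A (u i) = \<theta> i \<cdot> u i + u (Suc i)"
proof -
  have "tau_poly \<theta> (Suc i) = [:- \<theta> i, 1:] * tau_poly \<theta> i"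
    unfolding tau_poly_Suc by (rule mult.commute)
  then have "u (Suc i) = act A (u i) - \<theta> i \<cdot> u i"
    by (simp only: u_def alg_poly_mult alg_poly_linear act_mult act_linear_factor)
  then show ?thesis
    by simp
qed

lemma coord_u: "j \<le> d \<Longrightarrow> c j (u i) = poly (tau_poly \<theta> i) (\<theta> j) * c j (vs 0)"
  by (simp add: u_def a.coord_alg_poly)

lemma coord_u_below: "j < i \<Longrightarrow> j \<le> d \<Longrightarrow> c j (u i) = 0"
  by (simp add: coord_u a.tau_zero)

text \<open>By tridiagonality each application of \<open>A\<close> reaches one further eigenline of \<open>A\<^sup>*\<close>, and by
  irreducibility it does reach it.\<close>

lemma u_triangular:
  "i \<le> d \<Longrightarrow> (\<forall>j. i < j \<and> j \<le> d \<longrightarrow> cs j (u i) = 0) \<and> cs i (u i) \<noteq> 0"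
proof (induction i)
  case 0
  then show ?case
    by (auto simp: u_0 s.coord_basis)
next
  case (Suc i)
  then have above: "\<And>j. i < j \<Longrightarrow> j \<le> d \<Longrightarrow> cs j (u i) = 0" and diag: "cs i (u i) \<noteq> 0"
    by auto
  have step: "cs j (act A (u i)) = (if j = Suc i then cs i (u i) * cs (Suc i) (act A (vs i)) else 0)"
    if j: "i < j" "j \<le> d" for j
  proof -
    have "cs j (act A (u i)) = (\<Sum>k\<le>d. cs k (u i) * cs j (act A (vs k)))"
      using j by (simp add: s.coord_act)
    also have "\<dots> = (\<Sum>k\<le>d. if k = i then
        if j = Suc i then cs i (u i) * cs (Suc i) (act A (vs i)) else 0 else 0)"
    proof (intro sum.cong refl)
      fix k assume "k \<in> {..d}"
      then consider "k > i" | "k = i" | "k < i" "k \<le> d"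
        by force
      then show "cs k (u i) * cs j (act A (vs k)) = (if k = i then
        if j = Suc i then cs i (u i) * cs (Suc i) (act A (vs i)) else 0 else 0)"
      proof cases
        case 1
        then show ?thesis using above \<open>k \<in> {..d}\<close> by simp
      next
        case 2
        then show ?thesis using A_tridiagonal[of j k] j by auto
      next
        case 3
        then show ?thesis using A_tridiagonal[of j k] j by auto
      qed
    qed
    finally show ?thesis
      using Suc.prems by simp
  qed
  have "cs j (u (Suc i)) = (if j = Suc i then cs i (u i) * cs (Suc i) (act A (vs i)) else 0)"
    if j: "i < j" "j \<le> d" for j
    using step[OF j] above[OF j] j by (simp add: A_u s.coord_add s.coord_smul)
  then show ?case
    using diag A_irreducible[of "Suc i" i] Suc.prems by auto
qed

lemma u_spans_lower_flag:
  assumes "i \<le> d" "\<And>j. i < j \<Longrightarrow> j \<le> d \<Longrightarrow> cs j w = 0"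
  shows "\<exists>t. w = (\<Sum>k\<le>i. t k \<cdot> u k)"
  using assms
proof (induction i arbitrary: w)
  case 0
  have "w = cs 0 w \<cdot> u 0"
    using 0 by (intro s.coord_eqI) (auto simp: u_0 s.coord_smul s.coord_basis)
  then show ?case
    by (intro exI[of _ "\<lambda>_. cs 0 w"]) simp
next
  case (Suc i)
  define r where "r = cs (Suc i) w / cs (Suc i) (u (Suc i))"
  have nz: "cs (Suc i) (u (Suc i)) \<noteq> 0"
    and above: "\<And>j. Suc i < j \<Longrightarrow> j \<le> d \<Longrightarrow> cs j (u (Suc i)) = 0"
    using u_triangular[OF Suc.prems(1)] by auto
  have "cs j (w - r \<cdot> u (Suc i)) = 0" if "i < j" "j \<le> d" for j
  proof (cases "j = Suc i")
    case True
    then show ?thesis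
      using nz that by (simp add: r_def s.coord_diff s.coord_smul)
  next
    case False
    then show ?thesis
      using above[of j] Suc.prems(2)[of j] that by (simp add: s.coord_diff s.coord_smul)
  qed
  then obtain t where t: "w - r \<cdot> u (Suc i) = (\<Sum>k\<le>i. t k \<cdot> u k)"
    using Suc.IH[of "w - r \<cdot> u (Suc i)"] Suc.prems(1) by auto
  have "(\<Sum>k\<le>i. (t(Suc i := r)) k \<cdot> u k) = (\<Sum>k\<le>i. t k \<cdot> u k)"
    by (intro sum.cong) auto
  then have "(\<Sum>k\<le>Suc i. (t(Suc i := r)) k \<cdot> u k) = (w - r \<cdot> u (Suc i)) + r \<cdot> u (Suc i)"
    using t by simp
  then show ?case
    by (intro exI[of _ "t(Suc i := r)"]) simp
qed

lemma u_spans: obtains t where "w = (\<Sum>k\<le>d. t k \<cdot> u k)"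
  using u_spans_lower_flag[of d w] by auto

lemma eq_on_u:
  assumes "\<And>j. j \<le> d \<Longrightarrow> act x (u j) = act y (u j)"
  shows "x = y"
proof -
  have "act (x - y) w = 0" for w
  proof -
    obtain t where t: "w = (\<Sum>k\<le>d. t k \<cdot> u k)"
      by (rule u_spans)
    show ?thesis
      unfolding t act_sum_right act_smul using assms by (simp add: act_diff_left)
  qed
  then show ?thesis
    using faithful[of "x - y"] by simp
qed

text \<open>The vector \<open>vs 0\<close> is cyclic for \<open>A\<close>, so it has a component along every eigenvector of \<open>A\<close>.\<close>

lemma coord_vs_0_nonzero:
  assumes "j \<le> d"
  shows "c j (vs 0) \<noteq> 0"
proof
  assume "c j (vs 0) = 0"
  obtain t where t: "v j = (\<Sum>k\<le>d. t k \<cdot> u k)"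
    by (rule u_spans)
  have "c j (v j) = 0"
    unfolding t using assms \<open>c j (vs 0) = 0\<close> by (simp add: a.coord_sum a.coord_smul coord_u)
  then show False
    using assms by (simp add: a.coord_basis)
qed

text \<open>One-dimensionality of the split space. A vector of the lower flag is a combination of
  \<open>u 0, ..., u i\<close>; the vanishing of its coordinates \<open>c 0, ..., c (i - 1)\<close> removes the coefficients of
  \<open>u 0, ..., u (i - 1)\<close> one after the other, because \<open>c j\<close> kills every \<open>u k\<close> with \<open>k > j\<close> but not \<open>u j\<close>.\<close>

lemma u_line:
  assumes "i \<le> d" "\<And>j. i < j \<Longrightarrow> j \<le> d \<Longrightarrow> cs j w = 0" "\<And>j. j < i \<Longrightarrow> c j w = 0"
  shows "\<exists>t. w = t \<cdot> u i"
proof -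
  obtain t where t: "w = (\<Sum>k\<le>i. t k \<cdot> u k)"
    using u_spans_lower_flag[OF assms(1,2)] by blast
  have t_0: "j < i \<Longrightarrow> t j = 0" for j
  proof (induction j rule: less_induct)
    case (less j)
    have "j \<le> d"
      using less.prems assms(1) by simp
    have "c j w = (\<Sum>k\<le>i. t k * c j (u k))"
      unfolding t using \<open>j \<le> d\<close> by (simp add: a.coord_sum a.coord_smul)
    also have "\<dots> = (\<Sum>k\<le>i. if k = j then t k * c j (u k) else 0)"
    proof (intro sum.cong refl)
      fix k
      show "t k * c j (u k) = (if k = j then t k * c j (u k) else 0)"
        using less coord_u_below[of j k] \<open>j \<le> d\<close> by (cases k j rule: linorder_cases) auto
    qed
    finally have "t j * c j (u j) = 0"
      using less.prems assms(3)[of j] by simp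
    moreover have "c j (u j) \<noteq> 0"
      using \<open>j \<le> d\<close> by (simp add: coord_u a.tau_nonzero coord_vs_0_nonzero)
    ultimately show ?case
      by simp
  qed
  have "w = (\<Sum>k\<le>i. if k = i then t i \<cdot> u i else 0)"
    unfolding t by (intro sum.cong refl) (auto simp: t_0)
  then show ?thesis
    by auto
qed

lemma split_space_coords:
  assumes "w \<in> split_space act d E Es i" "i \<le> d"
  shows "i < j \<Longrightarrow> j \<le> d \<Longrightarrow> cs j w = 0" and "j < i \<Longrightarrow> c j w = 0"
proof -
  obtain f g where fg: "w = (\<Sum>h\<in>{0..i}. act (Es h) (f h))" "w = (\<Sum>h\<in>{i..d}. act (E h) (g h))"
    using assms(1) unfolding split_space_def sum_of_images_def by blast
  show "cs j w = 0" if "i < j" "j \<le> d"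
    unfolding fg(1) using that by (simp add: s.coord_sum s.coord_idempotent)
  show "c j w = 0" if "j < i"
    unfolding fg(2) using that assms(2) by (simp add: a.coord_sum a.coord_idempotent)
qed

lemma u_nonzero: "i \<le> d \<Longrightarrow> u i \<noteq> 0"
  using u_triangular[of i] s.coord_0[of i] by auto

lemma u_end: "u (Suc d) = 0"
  by (rule a.coord_eqI) (simp add: coord_u_below a.coord_0)

lemma As_u_0: "act As (u 0) = \<theta>s 0 \<cdot> u 0"
  by (simp add: u_0 s.act_eigenvector)

text \<open>The vector \<open>(A\<^sup>* - \<theta>\<^sup>*\<^sub>i) u\<^sub>i\<close> lies in the split space before that of \<open>u\<^sub>i\<close>, hence is \<open>t u\<^bsub>i-1\<^esub>\<close>.
  Applying \<open>A - \<theta>\<^bsub>i-1\<^esub>\<close> turns this into \<open>t u\<^sub>i\<close>, so \<open>t\<close> is the eigenvalue that defines the split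
  sequence.\<close>

lemma As_u:
  assumes "i < d"
  shows "act As (u (Suc i)) = \<theta>s (Suc i) \<cdot> u (Suc i) + \<phi> (Suc i) \<cdot> u i"
proof -
  define y where "y = act (As - scale (\<theta>s (Suc i)) 1) (u (Suc i))"
  have y_eq: "y = act As (u (Suc i)) - \<theta>s (Suc i) \<cdot> u (Suc i)"
    by (simp add: y_def act_linear_factor)
  have "cs j y = 0" if "i < j" "j \<le> d" for j
    using that u_triangular[of "Suc i"] assms
    by (cases "j = Suc i") (auto simp: y_eq s.coord_diff s.coord_smul s.coord_x)
  moreover have "c j y = 0" if "j < i" for j
  proof -
    have "c k (u (Suc i)) * c j (act As (v k)) = 0" if "k \<le> d" for k
      using coord_u_below[of k "Suc i"] As_tridiagonal[of j k] that \<open>j < i\<close> assms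
      by (cases "k < Suc i") auto
    then have "(\<Sum>k\<le>d. c k (u (Suc i)) * c j (act As (v k))) = 0"
      by (intro sum.neutral) simp
    then have "c j (act As (u (Suc i))) = 0"
      using a.coord_act[of j As "u (Suc i)"] that assms by simp
    then show ?thesis
      using that assms coord_u_below[of j "Suc i"] by (simp add: y_eq a.coord_diff a.coord_smul)
  qed
  ultimately obtain t where t: "y = t \<cdot> u i"
    using u_line[of i y] assms by auto
  have "Suc i \<in> {1..d}"
    using assms by simp
  then obtain w where w: "w \<in> split_space act d E Es (Suc i)" "w \<noteq> 0"
    "act ((A - scale (\<theta> i) 1) * (As - scale (\<theta>s (Suc i)) 1)) w = \<phi> (Suc i) \<cdot> w"
    using split_eigenvalue[of "Suc i"] by (auto simp: eigenvalue_on_def smul_def)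
  obtain r where r: "w = r \<cdot> u (Suc i)"
    using u_line[of "Suc i" w] split_space_coords[OF w(1)] assms by auto
  have "act ((A - scale (\<theta> i) 1) * (As - scale (\<theta>s (Suc i)) 1)) w = (r * t) \<cdot> u (Suc i)"
    unfolding act_mult r act_smul y_def[symmetric] t
    by (simp add: act_linear_factor A_u)
  then have "(r * t) \<cdot> u (Suc i) = (r * \<phi> (Suc i)) \<cdot> u (Suc i)"
    using w(3) r by (simp add: mult.commute)
  then have "t = \<phi> (Suc i)"
    using w(2) r u_nonzero[of "Suc i"] assms by auto
  then show ?thesis
    using t y_eq by (simp add: algebra_simps)
qed

section \<open>Identities compared on the split basis\<close>

text \<open>Up to a factor, \<open>c 0 \<circ> \<tau>\<^sup>*\<^sub>k(A\<^sup>*)\<close> is the functional dual to \<open>u k\<close>. Each new factor \<open>A\<^sup>* - \<theta>\<^sup>*\<^sub>k\<close>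
  maps \<open>u j\<close> into the span of \<open>u j\<close> and \<open>u (j - 1)\<close>; it has no \<open>u j\<close>-term precisely for \<open>j = k\<close>, the only
  index at which the previous functional would have seen it.\<close>

lemma coord_tau_u:
  assumes "k \<le> d" "j \<le> d"
  shows "c 0 (act (alg_poly scale (tau_poly \<theta>s k) As) (u j)) =
    (if j = k then (\<Prod>h=1..k. \<phi> h) * c 0 (vs 0) else 0)"
  using assms
proof (induction k arbitrary: j)
  case 0
  then show ?case
    by (auto simp: act_one u_0 coord_u_below)
next
  case (Suc k)
  have *: "act (alg_poly scale (tau_poly \<theta>s (Suc k)) As) (u j) =
      act (alg_poly scale (tau_poly \<theta>s k) As) (act As (u j) - \<theta>s k \<cdot> u j)"
    by (simp only: tau_poly_Suc alg_poly_mult alg_poly_linear act_mult act_linear_factor)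
  show ?case
  proof (cases j)
    case 0
    then show ?thesis
      using Suc unfolding * by (auto simp: As_u_0 act_diff_right act_smul a.coord_diff a.coord_smul)
  next
    case (Suc i)
    then show ?thesis
      using Suc.IH[of j] Suc.IH[of i] Suc.prems As_u[of i] unfolding *
      by (auto simp: act_diff_right act_add_right act_smul a.coord_diff a.coord_add a.coord_smul)
  qed
qed

text \<open>The mirror image, starting from the functional dual to \<open>u d\<close> and moving down with \<open>A\<close>.\<close>

lemma coord_eta_u:
  assumes "i \<le> d" "j \<le> d"
  shows "cs d (act (alg_poly scale (eta_poly d \<theta> i) A) (u j)) = (if j = d - i then cs d (u d) else 0)"
  using assms
proof (induction i arbitrary: j)
  case 0
  then show ?case
    using u_triangular[of j] by (auto simp: act_one)
next
  case (Suc i)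
  have *: "act (alg_poly scale (eta_poly d \<theta> (Suc i)) A) (u j) =
      act (alg_poly scale (eta_poly d \<theta> i) A) (\<theta> j \<cdot> u j + u (Suc j) - \<theta> (d - i) \<cdot> u j)"
    by (simp only: eta_poly_Suc alg_poly_mult alg_poly_linear act_mult act_linear_factor A_u)
  have "cs d (act (alg_poly scale (eta_poly d \<theta> i) A) (u (Suc j))) =
      (if j = d - Suc i then cs d (u d) else 0)"
  proof (cases "j = d")
    case True
    then show ?thesis
      using Suc.prems by (auto simp: u_end s.coord_0)
  next
    case False
    then show ?thesis
      using Suc.IH[of "Suc j"] Suc.prems by auto
  qed
  then show ?case
    using Suc.IH[of j] Suc.prems unfolding *
    by (auto simp: act_diff_right act_add_right act_smul s.coord_diff s.coord_add s.coord_smul)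
qed

text \<open>Both sides map into the line through \<open>v 0\<close> and vanish on every \<open>u j\<close> except \<open>u (d - i)\<close>. The scalar
  comes from \<open>\<tau>\<^sup>*\<^sub>d(A\<^sup>*) u\<^sub>d\<close>, whose \<open>c 0\<close>-coordinate is known in two ways: by descending to \<open>u 0\<close>, and because
  \<open>\<tau>\<^sup>*\<^sub>d(A\<^sup>*)\<close> is a multiple of \<open>E\<^sup>*\<^sub>d\<close>.\<close>

lemma E_0_Es_d_eta:
  assumes "i \<le> d"
  shows "E 0 * Es d * alg_poly scale (eta_poly d \<theta> i) A =
    scale ((\<Prod>h=d - i + 1..d. \<phi> h) / poly (tau_poly \<theta>s d) (\<theta>s d))
      (E 0 * alg_poly scale (tau_poly \<theta>s (d - i)) As)" (is "_ = scale (?\<Phi> / ?P) _")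
proof (rule eq_on_u)
  fix j assume j: "j \<le> d"
  have P: "?P \<noteq> 0"
    by (simp add: s.tau_nonzero)
  have "?P * (cs d (u d) * c 0 (vs d)) = (\<Prod>h=1..d. \<phi> h) * c 0 (vs 0)"
    using arg_cong[OF s.act_tau_last[of "u d"], of "c 0"] coord_tau_u[of d d]
    by (simp add: s.act_idempotent a.coord_smul)
  also have "\<dots> = ?\<Phi> * ((\<Prod>h=1..d - i. \<phi> h) * c 0 (vs 0))"
    using prod_split_nat[of "d - i" d \<phi>] by (simp add: mult_ac)
  finally have key: "cs d (u d) * c 0 (vs d) = ?\<Phi> / ?P * ((\<Prod>h=1..d - i. \<phi> h) * c 0 (vs 0))"
    using P by (simp add: field_simps)
  have "act (E 0 * Es d * alg_poly scale (eta_poly d \<theta> i) A) (u j) =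
      (if j = d - i then cs d (u d) * c 0 (vs d) else 0) \<cdot> v 0"
    using assms j by (simp add: act_mult s.act_idempotent a.act_idempotent act_smul coord_eta_u a.coord_smul)
  also have "\<dots> = act (scale (?\<Phi> / ?P) (E 0 * alg_poly scale (tau_poly \<theta>s (d - i)) As)) (u j)"
    using assms j by (simp add: act_scale act_mult a.act_idempotent coord_tau_u key)
  finally show "act (E 0 * Es d * alg_poly scale (eta_poly d \<theta> i) A) (u j) = \<dots>" .
qed

text \<open>Here both sides map into the line through \<open>vs d\<close> and vanish on every \<open>u j\<close> except \<open>u i\<close>; the scalar
  comes from the \<open>cs d\<close>-coordinate of \<open>\<eta>\<^sub>d(A) u\<^sub>0\<close>.\<close>

lemma Es_d_E_0_tau:
  assumes "i \<le> d"
  shows "Es d * E 0 * alg_poly scale (tau_poly \<theta>s i) As =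
    scale ((\<Prod>h=1..i. \<phi> h) / poly (eta_poly d \<theta> d) (\<theta> 0))
      (Es d * alg_poly scale (eta_poly d \<theta> (d - i)) A)" (is "_ = scale (?\<Phi> / ?P) _")
proof (rule eq_on_u)
  fix j assume j: "j \<le> d"
  have P: "?P \<noteq> 0"
    by (rule a.eta_nonzero)
  have "?P * (c 0 (vs 0) * cs d (v 0)) = cs d (u d)"
    using arg_cong[OF a.act_eta_first[of "u 0"], of "cs d"] coord_eta_u[of d 0]
    by (simp add: a.act_idempotent s.coord_smul u_0 mult.assoc)
  then have key: "c 0 (vs 0) * cs d (v 0) = cs d (u d) / ?P"
    using P by (simp add: field_simps)
  have "act (Es d * E 0 * alg_poly scale (tau_poly \<theta>s i) As) (u j) =
      (if j = i then ?\<Phi> * (c 0 (vs 0) * cs d (v 0)) else 0) \<cdot> vs d"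
    using assms j by (simp add: act_mult s.act_idempotent a.act_idempotent act_smul coord_tau_u s.coord_smul)
  also have "\<dots> = act (scale (?\<Phi> / ?P) (Es d * alg_poly scale (eta_poly d \<theta> (d - i)) A)) (u j)"
    using assms j by (simp add: act_scale act_mult s.act_idempotent coord_eta_u key)
  finally show "act (Es d * E 0 * alg_poly scale (tau_poly \<theta>s i) As) (u j) = \<dots>" .
qed

section \<open>Identities with the factors in opposite order\<close>

text \<open>The factors of \<open>\<eta>\<^sup>*\<^sub>m\<close> come in the order in which they meet \<open>u d, u (d - 1), ...\<close>, so each one
  cancels the diagonal term and lowers the index by one.\<close>

lemma eta_As_u:
  assumes "m \<le> d"
  shows "act (alg_poly scale (eta_poly d \<theta>s m) As) (u d) = (\<Prod>h=d - m + 1..d. \<phi> h) \<cdot> u (d - m)"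
  using assms
proof (induction m)
  case 0
  then show ?case
    by (simp add: act_one)
next
  case (Suc m)
  have "eta_poly d \<theta>s (Suc m) = [:- \<theta>s (d - m), 1:] * eta_poly d \<theta>s m"
    unfolding eta_poly_Suc by (rule mult.commute)
  then have "act (alg_poly scale (eta_poly d \<theta>s (Suc m)) As) (u d) =
      (\<Prod>h=d - m + 1..d. \<phi> h) \<cdot> (act As (u (d - m)) - \<theta>s (d - m) \<cdot> u (d - m))"
    using Suc by (simp only: alg_poly_mult alg_poly_linear act_mult act_smul act_linear_factor)
  also have "act As (u (d - m)) - \<theta>s (d - m) \<cdot> u (d - m) = \<phi> (d - m) \<cdot> u (d - Suc m)"
    using As_u[of "d - Suc m"] Suc.prems by (simp add: Suc_diff_Suc)
  also have "(\<Prod>h=d - m + 1..d. \<phi> h) \<cdot> \<phi> (d - m) \<cdot> u (d - Suc m) =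
      (\<Prod>h=d - Suc m + 1..d. \<phi> h) \<cdot> u (d - Suc m)"
    using Suc.prems prod.atLeast_Suc_atMost[of "d - m" d \<phi>] by (simp add: Suc_diff_Suc mult.commute)
  finally show ?case .
qed

lemma Es_0_u_d:
  "act (Es 0) (u d) = ((\<Prod>h=1..d. \<phi> h) / poly (eta_poly d \<theta>s d) (\<theta>s 0)) \<cdot> u 0" (is "_ = (?\<Phi> / ?P) \<cdot> _")
proof -
  have "?P \<cdot> act (Es 0) (u d) = ?\<Phi> \<cdot> u 0"
    using s.act_eta_first[of "u d"] eta_As_u[of d] by simp
  then have "(1 / ?P) \<cdot> ?P \<cdot> act (Es 0) (u d) = (1 / ?P) \<cdot> ?\<Phi> \<cdot> u 0"
    by (rule arg_cong)
  then show ?thesis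
    using s.eta_nonzero by simp
qed

text \<open>The factor \<open>E\<^sub>d\<close> on the right maps every vector to a multiple of \<open>u d\<close>, which spans \<open>E\<^sub>d V\<close>. On \<open>u d\<close>
  the left side descends to \<open>u 0\<close> and climbs back to \<open>u i\<close>; the right side descends to \<open>u i\<close> at once.\<close>

lemma tau_Es_0_E_d:
  assumes "i \<le> d"
  shows "alg_poly scale (tau_poly \<theta> i) A * (Es 0 * E d) =
    scale ((\<Prod>h=1..i. \<phi> h) / poly (eta_poly d \<theta>s d) (\<theta>s 0))
      (alg_poly scale (eta_poly d \<theta>s (d - i)) As * E d)" (is "_ = scale (?\<Phi> / ?P) _")
proof -
  have u_d: "u d = c d (u d) \<cdot> v d"
    by (rule a.coord_eqI) (auto simp: a.coord_smul a.coord_basis coord_u_below)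
  then have "c d (u d) \<noteq> 0"
    using u_nonzero[of d] by auto
  then have v_d: "v d = (1 / c d (u d)) \<cdot> u d"
    using arg_cong[OF u_d, of "\<lambda>w. (1 / c d (u d)) \<cdot> w"] by simp
  have "act (alg_poly scale (tau_poly \<theta> i) A) (act (Es 0) (u d)) =
      ((\<Prod>h=1..d. \<phi> h) / ?P) \<cdot> u i"
    unfolding Es_0_u_d act_smul by (simp add: u_def[of i] u_0)
  also have "\<dots> = (?\<Phi> / ?P) \<cdot> act (alg_poly scale (eta_poly d \<theta>s (d - i)) As) (u d)"
    using assms prod_split_nat[of i d \<phi>] by (simp add: eta_As_u)
  finally have key: "act (alg_poly scale (tau_poly \<theta> i) A) (act (Es 0) (u d)) = \<dots>" .
  have "act (alg_poly scale (tau_poly \<theta> i) A * (Es 0 * E d)) w =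
      act (scale (?\<Phi> / ?P) (alg_poly scale (eta_poly d \<theta>s (d - i)) As * E d)) w" for w
  proof -
    have "act (E d) w = (c d w / c d (u d)) \<cdot> u d"
      using a.act_idempotent[of d w] v_d by (metis V.scale_scale le_refl times_divide_eq_right mult.right_neutral)
    then show ?thesis
      by (simp add: act_mult act_scale act_smul key mult.commute)
  qed
  then show ?thesis
    by (intro eq_on_u)
qed

text \<open>The factor \<open>E\<^sup>*\<^sub>0\<close> on the right maps every vector to a multiple of \<open>u 0\<close>. On \<open>u 0\<close> the left side climbs
  to \<open>u d\<close> and descends to \<open>u (d - i)\<close>; the right side climbs to \<open>u (d - i)\<close> at once.\<close>

lemma eta_E_d_Es_0:
  assumes "i \<le> d"
  shows "alg_poly scale (eta_poly d \<theta>s i) As * (E d * Es 0) =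
    scale ((\<Prod>h=d - i + 1..d. \<phi> h) / poly (tau_poly \<theta> d) (\<theta> d))
      (alg_poly scale (tau_poly \<theta> (d - i)) A * Es 0)" (is "_ = scale (?\<Phi> / ?P) _")
proof -
  have P: "?P \<noteq> 0"
    by (simp add: a.tau_nonzero)
  have "?P \<cdot> act (E d) (vs 0) = u d"
    using a.act_tau_last[of "vs 0"] by (simp add: u_def)
  then have "(1 / ?P) \<cdot> ?P \<cdot> act (E d) (vs 0) = (1 / ?P) \<cdot> u d"
    by (rule arg_cong)
  then have "act (E d) (vs 0) = (1 / ?P) \<cdot> u d"
    using P by simp
  then have key: "act (alg_poly scale (eta_poly d \<theta>s i) As) (act (E d) (vs 0)) =
      (?\<Phi> / ?P) \<cdot> act (alg_poly scale (tau_poly \<theta> (d - i)) A) (vs 0)"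
    using assms by (simp add: act_smul eta_As_u u_def[of "d - i"])
  show ?thesis
    by (rule eq_on_u) (simp add: act_mult act_scale s.act_idempotent act_smul key mult.commute)
qed

section \<open>Transposition\<close>

text \<open>The diagonal scaling that makes the tridiagonal matrix of \<open>A\<close> in the eigenbasis of \<open>A\<^sup>*\<close>
  symmetric: the recursion is the symmetry condition for the pair of entries next to the diagonal.\<close>

primrec weight :: "nat \<Rightarrow> 'k" where
  "weight 0 = 1"
| "weight (Suc i) = weight i * cs i (act A (vs (Suc i))) / cs (Suc i) (act A (vs i))"

definition form :: "'v \<Rightarrow> 'v \<Rightarrow> 'k" where
  "form w w' = (\<Sum>i\<le>d. weight i * cs i w * cs i w')"

lemma weight_nonzero: "i \<le> d \<Longrightarrow> weight i \<noteq> 0"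
  by (induction i) (simp_all add: A_irreducible)

lemma weight_symmetric:
  assumes "i \<le> d" "j \<le> d"
  shows "weight i * cs i (act A (vs j)) = weight j * cs j (act A (vs i))"
proof -
  have step: "weight i * cs i (act A (vs (Suc i))) = weight (Suc i) * cs (Suc i) (act A (vs i))"
    if "Suc i \<le> d" for i
    using A_irreducible[of "Suc i" i] that by simp
  consider "i = j" | "j = Suc i" | "i = Suc j" | "\<bar>int i - int j\<bar> > 1"
    by linarith
  then show ?thesis
    using step[of i] step[of j] A_tridiagonal[of i j] A_tridiagonal[of j i] assms
    by cases (auto simp del: weight.simps)
qed

lemma form_add_left: "form (w1 + w2) w' = form w1 w' + form w2 w'"
  by (simp add: form_def s.coord_add algebra_simps sum.distrib)

lemma form_add_right: "form w (w1 + w2) = form w w1 + form w w2"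
  by (simp add: form_def s.coord_add algebra_simps sum.distrib)

lemma form_smul_left: "form (t \<cdot> w) w' = t * form w w'"
  by (simp add: form_def s.coord_smul sum_distrib_left mult_ac)

lemma form_smul_right: "form w (t \<cdot> w') = t * form w w'"
  by (simp add: form_def s.coord_smul sum_distrib_left mult_ac)

lemma form_vs_right: 
  assumes "j \<le> d"
  shows "form w (vs j) = weight j * cs j w"
proof -
  have "form w (vs j) = (\<Sum>i\<le>d. if i = j then weight j * cs j w else 0)"
    unfolding form_def by (intro sum.cong refl) (auto simp: s.coord_basis assms)
  then show ?thesis
    using assms by simp
qed

definition adjoint :: "'a \<Rightarrow> 'a \<Rightarrow> bool" where
  "adjoint x x' \<longleftrightarrow> (\<forall>w w'. form (act x w) w' = form w (act x' w'))"

lemma adjoint_As: "adjoint As As"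
  by (simp add: adjoint_def form_def s.coord_x mult_ac)

text \<open>Expanded in coordinates, self-adjointness is the symmetry of the weighted matrix of \<open>A\<close>.\<close>

lemma adjoint_A: "adjoint A A"
  unfolding adjoint_def
proof (intro allI)
  fix w w'
  have "form (act A w) w' = (\<Sum>i\<le>d. \<Sum>j\<le>d. weight i * cs i (act A (vs j)) * cs j w * cs i w')"
    by (simp add: form_def s.coord_act[of _ A w] sum_distrib_left sum_distrib_right mult_ac)
  also have "\<dots> = (\<Sum>j\<le>d. \<Sum>i\<le>d. weight j * cs j (act A (vs i)) * cs j w * cs i w')"
    by (subst sum.swap) (intro sum.cong refl, simp add: weight_symmetric)
  also have "\<dots> = form w (act A w')"
    by (simp add: form_def s.coord_act[of _ A w'] sum_distrib_left sum_distrib_right mult_ac)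
  finally show "form (act A w) w' = form w (act A w')" .
qed

lemma adjoint_mult: "adjoint x x' \<Longrightarrow> adjoint y y' \<Longrightarrow> adjoint (x * y) (y' * x')"
  by (simp add: adjoint_def act_mult)

lemma adjoint_scale: "adjoint x x' \<Longrightarrow> adjoint (scale t x) (scale t x')"
  by (simp add: adjoint_def act_scale form_smul_left form_smul_right)

lemma adjoint_alg_poly:
  assumes "adjoint x x"
  shows "adjoint (alg_poly scale p x) (alg_poly scale p x)"
proof (induction p)
  case 0
  show ?case
    by (simp add: adjoint_def form_def s.coord_0)
next
  case (pCons t p)
  have "x * alg_poly scale p x = alg_poly scale p x * x"
    using alg_poly_mult[of "[:0, 1:]" p x] alg_poly_mult[of p "[:0, 1:]" x]
    by (simp add: alg_poly_pCons mult.commute)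
  then show ?case
    using adjoint_mult[OF assms pCons.IH]
    by (simp add: adjoint_def alg_poly_pCons act_add_left act_scale act_one
        form_add_left form_add_right form_smul_left form_smul_right)
qed

text \<open>The extreme idempotents are polynomials in \<open>A\<close> and \<open>A\<^sup>*\<close>, hence inherit self-adjointness.\<close>

lemma adjoint_E_d: "adjoint (E d) (E d)"
proof -
  have "E d = scale (1 / poly (tau_poly \<theta> d) (\<theta> d)) (alg_poly scale (tau_poly \<theta> d) A)"
    by (rule eq_on_u) (simp add: act_scale a.act_tau_last a.tau_nonzero)
  then show ?thesis
    using adjoint_scale[OF adjoint_alg_poly[OF adjoint_A]] by metis
qed

lemma adjoint_Es_0: "adjoint (Es 0) (Es 0)"
proof -
  have "Es 0 = scale (1 / poly (eta_poly d \<theta>s d) (\<theta>s 0)) (alg_poly scale (eta_poly d \<theta>s d) As)"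
    by (rule eq_on_u) (simp add: act_scale s.act_eta_first s.eta_nonzero)
  then show ?thesis
    using adjoint_scale[OF adjoint_alg_poly[OF adjoint_As]] by metis
qed

text \<open>Nondegeneracy of the form and faithfulness of the module: an element is determined by its adjoint,
  so an identity may be proved with its factors in the opposite order.\<close>

lemma adjoint_unique:
  assumes "adjoint x z" "adjoint y z"
  shows "x = y"
proof (rule eq_on_u, rule s.coord_eqI)
  fix i j assume "i \<le> d"
  have "form (act x (u j)) (vs i) = form (act y (u j)) (vs i)"
    using assms by (simp add: adjoint_def)
  then show "cs i (act x (u j)) = cs i (act y (u j))"
    using \<open>i \<le> d\<close> by (simp add: form_vs_right weight_nonzero)
qed

lemma E_d_Es_0_tau:
  assumes "i \<le> d"
  shows "E d * Es 0 * alg_poly scale (tau_poly \<theta> i) A =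
    scale ((\<Prod>h=1..i. \<phi> h) / poly (eta_poly d \<theta>s d) (\<theta>s 0))
      (E d * alg_poly scale (eta_poly d \<theta>s (d - i)) As)"
proof (rule adjoint_unique)
  show "adjoint (E d * Es 0 * alg_poly scale (tau_poly \<theta> i) A)
      (alg_poly scale (tau_poly \<theta> i) A * (Es 0 * E d))"
    by (intro adjoint_mult adjoint_E_d adjoint_Es_0 adjoint_alg_poly adjoint_A)
  show "adjoint (scale ((\<Prod>h=1..i. \<phi> h) / poly (eta_poly d \<theta>s d) (\<theta>s 0))
      (E d * alg_poly scale (eta_poly d \<theta>s (d - i)) As))
      (alg_poly scale (tau_poly \<theta> i) A * (Es 0 * E d))"
    unfolding tau_Es_0_E_d[OF assms]
    by (intro adjoint_scale adjoint_mult adjoint_E_d adjoint_alg_poly adjoint_As)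
qed

lemma Es_0_E_d_eta:
  assumes "i \<le> d"
  shows "Es 0 * E d * alg_poly scale (eta_poly d \<theta>s i) As =
    scale ((\<Prod>h=d - i + 1..d. \<phi> h) / poly (tau_poly \<theta> d) (\<theta> d))
      (Es 0 * alg_poly scale (tau_poly \<theta> (d - i)) A)"
proof (rule adjoint_unique)
  show "adjoint (Es 0 * E d * alg_poly scale (eta_poly d \<theta>s i) As)
      (alg_poly scale (eta_poly d \<theta>s i) As * (E d * Es 0))"
    by (intro adjoint_mult adjoint_E_d adjoint_Es_0 adjoint_alg_poly adjoint_As)
  show "adjoint (scale ((\<Prod>h=d - i + 1..d. \<phi> h) / poly (tau_poly \<theta> d) (\<theta> d))
      (Es 0 * alg_poly scale (tau_poly \<theta> (d - i)) A))
      (alg_poly scale (eta_poly d \<theta>s i) As * (E d * Es 0))"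
    unfolding eta_E_d_Es_0[OF assms]
    by (intro adjoint_scale adjoint_mult adjoint_Es_0 adjoint_alg_poly adjoint_A)
qed

end

section \<open>The eight identities\<close>

theorem corollary5p3:
  fixes scale :: "'k::field \<Rightarrow> 'a::ring_1 \<Rightarrow> 'a"
    and act :: "'a \<Rightarrow> 'v::ab_group_add \<Rightarrow> 'v"
    and d :: nat
    and A As :: 'a and E Es :: "nat \<Rightarrow> 'a"
    and \<theta> \<theta>s varphi phi :: "nat \<Rightarrow> 'k"
  assumes "K_algebra scale"
    and "isomorphic_to_Mat scale (d + 1)"
    and "simple_left_module act"
    and "leonard_system scale act d A E As Es"
    and "parameter_array scale act d A E As Es \<theta> \<theta>s varphi phi"
  shows "\<forall>i\<le>d.
    E 0 * Es 0 * alg_poly scale (eta_poly d \<theta> i) A =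
      scale ((\<Prod>h=1..i. phi h) / poly (eta_poly d \<theta>s d) (\<theta>s 0))
        (E 0 * alg_poly scale (eta_poly d \<theta>s (d - i)) As) \<and>
    E 0 * Es d * alg_poly scale (eta_poly d \<theta> i) A =
      scale ((\<Prod>h=d - i + 1..d. varphi h) / poly (tau_poly \<theta>s d) (\<theta>s d))
        (E 0 * alg_poly scale (tau_poly \<theta>s (d - i)) As) \<and>
    E d * Es 0 * alg_poly scale (tau_poly \<theta> i) A =
      scale ((\<Prod>h=1..i. varphi h) / poly (eta_poly d \<theta>s d) (\<theta>s 0))
        (E d * alg_poly scale (eta_poly d \<theta>s (d - i)) As) \<and>
    E d * Es d * alg_poly scale (tau_poly \<theta> i) A =
      scale ((\<Prod>h=d - i + 1..d. phi h) / poly (tau_poly \<theta>s d) (\<theta>s d))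
        (E d * alg_poly scale (tau_poly \<theta>s (d - i)) As) \<and>
    Es 0 * E 0 * alg_poly scale (eta_poly d \<theta>s i) As =
      scale ((\<Prod>h=d - i + 1..d. phi h) / poly (eta_poly d \<theta> d) (\<theta> 0))
        (Es 0 * alg_poly scale (eta_poly d \<theta> (d - i)) A) \<and>
    Es 0 * E d * alg_poly scale (eta_poly d \<theta>s i) As =
      scale ((\<Prod>h=d - i + 1..d. varphi h) / poly (tau_poly \<theta> d) (\<theta> d))
        (Es 0 * alg_poly scale (tau_poly \<theta> (d - i)) A) \<and>
    Es d * E 0 * alg_poly scale (tau_poly \<theta>s i) As =
      scale ((\<Prod>h=1..i. varphi h) / poly (eta_poly d \<theta> d) (\<theta> 0))
        (Es d * alg_poly scale (eta_poly d \<theta> (d - i)) A) \<and>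
    Es d * E d * alg_poly scale (tau_poly \<theta>s i) As =
      scale ((\<Prod>h=1..i. phi h) / poly (tau_poly \<theta> d) (\<theta> d))
        (Es d * alg_poly scale (tau_poly \<theta> (d - i)) A)"
proof -
  interpret algebra_module scale act
    using assms(1,3) by (simp add: algebra_module_def simple_left_module_def)
  obtain S where S: "finite S" "card S \<le> d + 1" "V.span S = UNIV"
    and faithful: "\<And>x. (\<And>w. act x w = 0) \<Longrightarrow> x = 0"
    using spanned_and_faithful[OF assms(2,3)] by blast
  have ordering: "idempotents_for scale act d A E \<theta>" "idempotents_for scale act d As Es \<theta>s"
    and split: "first_split_sequence scale act d A E As Es \<theta> \<theta>s varphi"
    "first_split_sequence scale act d A (\<lambda>i. E (d - i)) As Es (\<lambda>i. \<theta> (d - i)) \<theta>s phi"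
    using assms(5) by (auto simp: parameter_array_def)
  obtain v c where a: "eigenbasis scale act d A E \<theta> v c"
    using eigenbasis_exists[OF S ordering(1)] by blast
  obtain vs cs where s: "eigenbasis scale act d As Es \<theta>s vs cs"
    using eigenbasis_exists[OF S ordering(2)] by blast
  have tridiagonal: "i \<le> d \<Longrightarrow> j \<le> d \<Longrightarrow> \<bar>int i - int j\<bar> > 1 \<Longrightarrow> E i * As * E j = 0"
    "i \<le> d \<Longrightarrow> j \<le> d \<Longrightarrow> \<bar>int i - int j\<bar> > 1 \<Longrightarrow> Es i * A * Es j = 0"
    "i \<le> d \<Longrightarrow> j \<le> d \<Longrightarrow> \<bar>int i - int j\<bar> = 1 \<Longrightarrow> Es i * A * Es j \<noteq> 0" for i j
    using assms(4) by (auto simp: leonard_system_def)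
  interpret down: split_system scale act d A E \<theta> v c As Es \<theta>s vs cs varphi
    using a s faithful tridiagonal split(1) algebra_module_axioms
    by (simp add: split_system_def split_system_axioms_def first_split_sequence_def)
  interpret up: split_system scale act d A "\<lambda>i. E (d - i)" "\<lambda>i. \<theta> (d - i)" "\<lambda>i. v (d - i)"
    "\<lambda>i. c (d - i)" As Es \<theta>s vs cs phi
    using eigenbasis.eigenbasis_rev[OF a] s faithful tridiagonal split(2) algebra_module_axioms
    by (simp add: split_system_def split_system_axioms_def first_split_sequence_def of_nat_diff)
  show ?thesis
    using down.E_0_Es_d_eta down.Es_d_E_0_tau down.E_d_Es_0_tau down.Es_0_E_d_eta
      up.E_0_Es_d_eta up.Es_d_E_0_tau up.E_d_Es_0_tau up.Es_0_E_d_eta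
    by (simp add: tau_poly_rev eta_poly_rev)
qed

end
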